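(* There is a function $\varepsilon_d$ with $\varepsilon_d\to 0$ as $d\to\infty$ such that the following holds. There is a constant $\gamma$ (independent of $n$) such that, for any integer $k\leq(1-\varepsilon_d)\frac{\ln d}{d}\cdot n$, with high probability the set $\mathcal{S}_k(G(n,m))$ is $\gamma$-connected.
   Context: $G(n,m)$ is the random graph on vertex set $V=\{1,\dots,n\}$ obtained by choosing $m$ edges uniformly at random without replacement; $d=2m/n$ is the average degree, which is held fixed as $n\to\infty$. "With high probability" (w.h.p.) means with probability tending to $1$ as $n\to\infty$. For a graph $G$ and an integer $k$, $\mathcal{S}_k(G)$ denotes the set of all independent sets of $G$ of size exactly $k$. For $S,T\subseteq V$, $\mathrm{dist}(S,T)=|S\triangle T|$ (Hamming distance). A family $\mathcal{S}$ of subsets of $V$ is $\gamma$-connected if for any $\sigma,\tau\in\mathcal{S}$ there are $\sigma_1,\dots,\sigma_N\in\mathcal{S}$ with $\sigma_1=\sigma$, $\sigma_N=\tau$ and $\mathrm{dist}(\sigma_t,\sigma_{t+1})\leq\gamma$ for all $1\leq t<N$. *)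

theory Defs
  imports "HOL-Probability.Probability"
begin

definition all_edges :: "nat \<Rightarrow> nat set set" where
  "all_edges n = {e. e \<subseteq> {1..n} \<and> card e = 2}"

definition gnm_graphs :: "nat \<Rightarrow> nat \<Rightarrow> nat set set set" where
  "gnm_graphs n m = {E. E \<subseteq> all_edges n \<and> card E = m}"

definition Gnm :: "nat \<Rightarrow> nat \<Rightarrow> nat set set pmf" where
  "Gnm n m = pmf_of_set (gnm_graphs n m)"

definition indep_sets :: "nat \<Rightarrow> nat set set \<Rightarrow> nat \<Rightarrow> nat set set" where
  "indep_sets n E k = {S. S \<subseteq> {1..n} \<and> card S = k \<and> (\<forall>e\<in>E. \<not> e \<subseteq> S)}"

definition hdist :: "'a set \<Rightarrow> 'a set \<Rightarrow> nat" where
  "hdist S T = card ((S - T) \<union> (T - S))"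

definition gamma_connected :: "nat \<Rightarrow> 'a set set \<Rightarrow> bool" where
  "gamma_connected \<gamma> F \<longleftrightarrow>
     (\<forall>\<sigma>\<in>F. \<forall>\<tau>\<in>F. \<exists>xs. xs \<noteq> [] \<and> hd xs = \<sigma> \<and> last xs = \<tau> \<and> set xs \<subseteq> F \<and>
        (\<forall>t. Suc t < length xs \<longrightarrow> hdist (xs ! t) (xs ! Suc t) \<le> \<gamma>))"

end

theory Submission
  imports Defs "HOL-Real_Asymp.Real_Asymp"
begin

text \<open>
  To move from an independent set \<open>\<sigma>\<close> towards another one \<open>\<tau>\<close> of the same size \<open>k\<close>, choose a vertex
  \<open>t \<in> \<tau> - \<sigma>\<close> with few neighbours in \<open>\<sigma> - \<tau>\<close>, replace these neighbours by \<open>t\<close>, and refill to size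
  \<open>k\<close> with arbitrary free vertices. The set \<open>\<tau> - \<sigma>\<close> shrinks, because no neighbour of \<open>t\<close> lies in
  \<open>\<tau>\<close>. Two properties make every step possible, and both hold with high probability.

  First, no set of size \<open>k\<close> dominates the graph, so a set of size less than \<open>k\<close> always leaves a free
  vertex. About \<open>n d\<^sup>\<epsilon> / d\<close> vertices are expected to have no neighbour in a given set of size
  \<open>(1 - \<epsilon>) (ln d / d) n\<close>, which for \<open>d\<^sup>\<epsilon> = 12 (ln d)\<^sup>2\<close> outweighs the logarithm of the number of such
  sets, at most \<open>2 n (ln d)\<^sup>2 / d\<close>. The probability is computed for independent edges of density
  \<open>m / N\<close> and transferred to exactly \<open>m\<close> edges at the cost of a factor \<open>N + 1\<close>.

  Second, for a constant \<open>\<Delta>\<close> depending only on \<open>d\<close>, no two disjoint sets of equal size \<open>s\<close> have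
  \<open>\<Delta> s\<close> or more edges between them, so a suitable \<open>t\<close> exists.
\<close>

section \<open>Moving between independent sets of a fixed graph\<close>

lemma hdist_swap_le:
  assumes "finite \<sigma>" "finite \<tau>" "card \<sigma> = card \<tau>" "card (\<sigma> - \<tau>) \<le> r"
  shows "hdist \<sigma> \<tau> \<le> 2 * r"
proof -
  have "card (\<tau> - \<sigma>) = card (\<sigma> - \<tau>)"
    using assms by (metis card_le_sym_Diff le_antisym le_refl)
  moreover have "hdist \<sigma> \<tau> \<le> card (\<sigma> - \<tau>) + card (\<tau> - \<sigma>)"
    unfolding hdist_def by (rule card_Un_le)
  ultimately show ?thesis using assms(4) by linarith
qed

text \<open>Potential argument: with the target \<open>\<tau>\<close> fixed, every step strictly
  lowers a natural number, so induction on \<open>\<mu> \<sigma> \<tau>\<close> builds the path, and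
  the descent can only stop at \<open>\<tau>\<close>.\<close>

lemma gamma_connectedI:
  fixes \<mu> :: "'a set \<Rightarrow> 'a set \<Rightarrow> nat"
  assumes step: "\<And>\<sigma> \<tau>. \<sigma> \<in> F \<Longrightarrow> \<tau> \<in> F \<Longrightarrow> \<sigma> \<noteq> \<tau> \<Longrightarrow>
    \<exists>\<sigma>'\<in>F. hdist \<sigma> \<sigma>' \<le> \<gamma> \<and> \<mu> \<sigma>' \<tau> < \<mu> \<sigma> \<tau>"
  shows "gamma_connected \<gamma> F"
  unfolding gamma_connected_def
proof (intro ballI)
  fix \<sigma> \<tau> assume "\<sigma> \<in> F" "\<tau> \<in> F"
  then show "\<exists>xs. xs \<noteq> [] \<and> hd xs = \<sigma> \<and> last xs = \<tau> \<and> set xs \<subseteq> F \<and>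
        (\<forall>t. Suc t < length xs \<longrightarrow> hdist (xs ! t) (xs ! Suc t) \<le> \<gamma>)"
  proof (induction "\<mu> \<sigma> \<tau>" arbitrary: \<sigma> rule: less_induct)
    case less
    show ?case
    proof (cases "\<sigma> = \<tau>")
      case True
      then show ?thesis using less.prems by (intro exI[of _ "[\<tau>]"]) auto
    next
      case False
      then obtain \<sigma>' where \<sigma>': "\<sigma>' \<in> F" "hdist \<sigma> \<sigma>' \<le> \<gamma>" "\<mu> \<sigma>' \<tau> < \<mu> \<sigma> \<tau>"
        using step less.prems by blast
      obtain xs where xs: "xs \<noteq> []" "hd xs = \<sigma>'" "last xs = \<tau>" "set xs \<subseteq> F"
        "\<And>t. Suc t < length xs \<Longrightarrow> hdist (xs ! t) (xs ! Suc t) \<le> \<gamma>"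
        using less.hyps[OF \<sigma>'(3,1) less.prems(2)] by blast
      have "hdist ((\<sigma> # xs) ! t) ((\<sigma> # xs) ! Suc t) \<le> \<gamma>" if "Suc t < length (\<sigma> # xs)" for t
        using that \<sigma>'(2) xs(1,2,5) by (cases t) (auto simp: hd_conv_nth)
      then show ?thesis using xs less.prems by (intro exI[of _ "\<sigma> # xs"]) auto
    qed
  qed
qed

lemma no_edge_in_insert:
  assumes "E \<subseteq> all_edges n" "\<And>e. e \<in> E \<Longrightarrow> \<not> e \<subseteq> S" "\<And>u. u \<in> S \<Longrightarrow> {u, v} \<notin> E" "e \<in> E"
  shows "\<not> e \<subseteq> insert v S"
proof
  assume sub: "e \<subseteq> insert v S"
  have "card e = 2" using assms(1,4) by (auto simp: all_edges_def)
  then obtain a b where e: "e = {a, b}" "a \<noteq> b" by (auto simp: card_2_iff)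
  have "v \<in> e" using sub assms(2)[OF assms(4)] by auto
  then obtain u where "e = {u, v}" "u \<noteq> v" using e by auto
  then show False using sub assms(3)[of u] assms(4) by auto
qed

text \<open>The set is filled greedily, one free vertex at a time; \<open>ext\<close> applies at
  every stage because it covers all sets of size below \<open>k\<close>.\<close>

lemma indep_set_extend:
  assumes E: "E \<subseteq> all_edges n"
    and ext: "\<And>S. S \<subseteq> {1..n} \<Longrightarrow> card S < k \<Longrightarrow> \<exists>v\<in>{1..n} - S. \<forall>u\<in>S. {u, v} \<notin> E"
    and S: "S \<in> indep_sets n E j" "j \<le> k"
  shows "\<exists>S'\<in>indep_sets n E k. S \<subseteq> S'"
  using S
proof (induction "k - j" arbitrary: S j)
  case 0
  then show ?case by auto
next
  case (Suc i)
  have S: "S \<subseteq> {1..n}" "card S = j" "\<And>e. e \<in> E \<Longrightarrow> \<not> e \<subseteq> S"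
    using Suc.prems by (auto simp: indep_sets_def)
  have fin: "finite S" using S(1) finite_subset by blast
  obtain v where v: "v \<in> {1..n} - S" "\<And>u. u \<in> S \<Longrightarrow> {u, v} \<notin> E"
    using ext[OF S(1)] S(2) Suc.hyps(2) Suc.prems(2) by force
  have "\<not> e \<subseteq> insert v S" if "e \<in> E" for e
    using no_edge_in_insert[OF E S(3) v(2)] that by blast
  then have "insert v S \<in> indep_sets n E (Suc j)"
    using S v(1) fin by (auto simp: indep_sets_def)
  moreover have "i = k - Suc j" "Suc j \<le> k" using Suc.hyps(2) by auto
  ultimately show ?case using Suc.hyps(1) by blast
qed

text \<open>In one step at most \<open>\<Delta>\<close> neighbours of \<open>t\<close> and possibly
  one further vertex leave \<open>\<sigma>\<close>, and as many vertices enter as leave, which gives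
  the radius \<open>2 * Suc \<Delta>\<close>.\<close>

theorem gamma_connected_indep_sets:
  assumes E: "E \<subseteq> all_edges n"
    and ext: "\<And>S. S \<subseteq> {1..n} \<Longrightarrow> card S < k \<Longrightarrow> \<exists>v\<in>{1..n} - S. \<forall>u\<in>S. {u, v} \<notin> E"
    and sparse: "\<And>A B. A \<subseteq> {1..n} \<Longrightarrow> B \<subseteq> {1..n} \<Longrightarrow> A \<inter> B = {} \<Longrightarrow> card A = card B \<Longrightarrow>
      A \<noteq> {} \<Longrightarrow> \<exists>t\<in>A. card {u\<in>B. {u, t} \<in> E} \<le> \<Delta>"
  shows "gamma_connected (2 * Suc \<Delta>) (indep_sets n E k)"
proof (rule gamma_connectedI[where \<mu> = "\<lambda>\<sigma> \<tau>. card (\<tau> - \<sigma>)"])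
  fix \<sigma> \<tau> assume st: "\<sigma> \<in> indep_sets n E k" "\<tau> \<in> indep_sets n E k" "\<sigma> \<noteq> \<tau>"
  have \<sigma>: "\<sigma> \<subseteq> {1..n}" "card \<sigma> = k" "\<And>e. e \<in> E \<Longrightarrow> \<not> e \<subseteq> \<sigma>"
    and \<tau>: "\<tau> \<subseteq> {1..n}" "card \<tau> = k" "\<And>e. e \<in> E \<Longrightarrow> \<not> e \<subseteq> \<tau>"
    using st by (auto simp: indep_sets_def)
  have fin: "finite \<sigma>" "finite \<tau>" using \<sigma>(1) \<tau>(1) finite_subset by blast+
  have cards: "card (\<tau> - \<sigma>) = card (\<sigma> - \<tau>)"
    using fin \<sigma>(2) \<tau>(2) by (metis card_le_sym_Diff le_antisym le_refl)
  have ne: "\<tau> - \<sigma> \<noteq> {}"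
    using st(3) fin \<sigma>(2) \<tau>(2) by (metis Diff_eq_empty_iff card_subset_eq)
  then obtain b where b: "b \<in> \<sigma> - \<tau>"
    using cards fin by (metis card_0_eq equals0I finite_Diff)
  obtain t where t: "t \<in> \<tau> - \<sigma>" "card {u\<in>\<sigma> - \<tau>. {u, t} \<in> E} \<le> \<Delta>"
    using sparse[of "\<tau> - \<sigma>" "\<sigma> - \<tau>"] \<sigma>(1) \<tau>(1) ne cards by auto
  \<comment> \<open>\<open>b\<close> is removed in case \<open>t\<close> has no neighbour in \<open>\<sigma>\<close>: adding \<open>t\<close> must not exceed size \<open>k\<close>.\<close>
  define R where "R = insert b {u\<in>\<sigma> - \<tau>. {u, t} \<in> E}"
  have R: "R \<subseteq> \<sigma> - \<tau>" "card R \<le> Suc \<Delta>" "b \<in> R"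
    using b t(2) fin unfolding R_def by (auto intro: order_trans[OF card_insert_le_m1] simp: card_insert_if)
  have finR: "finite R" using R(1) fin finite_subset by blast
  \<comment> \<open>All neighbours of \<open>t\<close> in \<open>\<sigma>\<close> lie in
    \<open>R\<close>: those outside \<open>\<tau>\<close> by definition, and inside
    \<open>\<tau>\<close> there are none, since \<open>\<tau>\<close> is independent and contains
    \<open>t\<close>.\<close>
  have "{u, t} \<notin> E" if "u \<in> \<sigma> - R" for u
  proof (cases "u \<in> \<tau>")
    case True
    then show ?thesis using \<tau>(3)[of "{u, t}"] t(1) by auto
  qed (use that in \<open>auto simp: R_def\<close>)
  then have "\<not> e \<subseteq> insert t (\<sigma> - R)" if "e \<in> E" for e
    using no_edge_in_insert[OF E, of "\<sigma> - R" t e] \<sigma>(3) that by blast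
  moreover have le_k: "card (insert t (\<sigma> - R)) \<le> k"
  proof -
    have "card (\<sigma> - R) < card \<sigma>"
      using R b fin by (intro psubset_card_mono) auto
    then show ?thesis using t(1) fin \<sigma>(2) by auto
  qed
  moreover have "insert t (\<sigma> - R) \<subseteq> {1..n}" using t(1) \<sigma>(1) \<tau>(1) by auto
  ultimately have "insert t (\<sigma> - R) \<in> indep_sets n E (card (insert t (\<sigma> - R)))"
    by (auto simp: indep_sets_def)
  then obtain \<sigma>' where \<sigma>': "\<sigma>' \<in> indep_sets n E k" "insert t (\<sigma> - R) \<subseteq> \<sigma>'"
    using indep_set_extend[OF E ext] le_k by blast
  have "card (\<sigma> - \<sigma>') \<le> card R" using \<sigma>'(2) finR by (intro card_mono) auto
  then have "hdist \<sigma> \<sigma>' \<le> 2 * Suc \<Delta>"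
    using fin(1) finite_subset[of \<sigma>' "{1..n}"] \<sigma>'(1) \<sigma>(2) R(2)
    by (intro hdist_swap_le) (auto simp: indep_sets_def)
  \<comment> \<open>\<open>R\<close> misses \<open>\<tau>\<close>, so no vertex of
    \<open>\<sigma> \<inter> \<tau>\<close> is lost, while \<open>t\<close> is gained.\<close>
  moreover have "card (\<tau> - \<sigma>') < card (\<tau> - \<sigma>)"
    using \<sigma>'(2) t(1) R(1) fin by (intro psubset_card_mono) auto
  ultimately show "\<exists>\<sigma>'\<in>indep_sets n E k. hdist \<sigma> \<sigma>' \<le> 2 * Suc \<Delta> \<and> card (\<tau> - \<sigma>') < card (\<tau> - \<sigma>)"
    using \<sigma>'(1) by blast
qed

section \<open>Counting edge sets of a given size by comparison with independent edges\<close>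

text \<open>For \<open>p\<close> in the unit interval the summand is the probability of
  \<open>E\<close> when each element of \<open>B\<close> is chosen independently with probability
  \<open>p\<close>. Hitting the various \<open>D v\<close> concerns disjoint groups of elements, so
  these events are independent, and \<open>D v\<close> is missed with probability
  \<open>q ^ card (D v)\<close>.\<close>

lemma sum_hitting_weights:
  fixes p q :: real
  assumes "p + q = 1" "finite I" "finite B" "\<And>v. v \<in> I \<Longrightarrow> D v \<subseteq> B"
    and "disjoint_family_on D I"
  shows "(\<Sum>E | E \<subseteq> B \<and> (\<forall>v\<in>I. E \<inter> D v \<noteq> {}). p ^ card E * q ^ card (B - E))
    = (\<Prod>v\<in>I. 1 - q ^ card (D v))"
  using assms(2-)
proof (induction I arbitrary: B rule: finite_induct)
  case empty
  have "(\<Sum>E\<in>Pow B. p ^ card E * q ^ card (B - E)) = (\<Prod>x\<in>B. p + q)"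
    using empty by (subst prod_add) auto
  then show ?case using assms(1) by (simp add: Pow_def)
next
  case (insert v I)
  define B' where "B' = B - D v"
  define w where "w B E = p ^ card E * q ^ card (B - E)" for B E :: "'b set"
  have "D v \<subseteq> B" using insert.prems(2) by simp
  then have Dv: "D v \<subseteq> B" "finite (D v)" "finite B'"
    using insert.prems(1) finite_subset unfolding B'_def by auto
  have disj: "D v \<inter> D u = {}" if "u \<in> I" for u
    using disjoint_family_onD[OF insert.prems(3), of v u] insert.hyps(2) that by auto
  have IH: "(\<Sum>E | E \<subseteq> B' \<and> (\<forall>v\<in>I. E \<inter> D v \<noteq> {}). w B' E) = (\<Prod>v\<in>I. 1 - q ^ card (D v))"
    unfolding w_def
  proof (rule insert.IH)
    show "D u \<subseteq> B'" if "u \<in> I" for u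
      using that insert.prems(2) disj[OF that] unfolding B'_def by blast
    show "disjoint_family_on D I"
      using insert.prems(3) by (auto simp: disjoint_family_on_def)
  qed fact
  have "(\<Sum>E\<in>Pow (D v). w (D v) E) = (\<Prod>x\<in>D v. p + q)"
    using Dv by (subst prod_add) (auto simp: w_def)
  then have first: "(\<Sum>E\<in>Pow (D v) - {{}}. w (D v) E) = 1 - q ^ card (D v)"
    using assms(1) Dv(2) by (subst sum_diff) (auto simp: w_def)
  have w_split: "w B (E \<union> E') = w (D v) E * w B' E'" if "E \<subseteq> D v" "E' \<subseteq> B'" for E E'
  proof -
    have "card (E \<union> E') = card E + card E'"
      using that Dv unfolding B'_def by (intro card_Un_disjoint) (auto intro: finite_subset)
    moreover have "B - (E \<union> E') = (D v - E) \<union> (B' - E')"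
      using that Dv unfolding B'_def by blast
    moreover have "card ((D v - E) \<union> (B' - E')) = card (D v - E) + card (B' - E')"
      using that Dv unfolding B'_def by (intro card_Un_disjoint) auto
    ultimately show ?thesis by (simp add: w_def power_add)
  qed
  \<comment> \<open>Splitting \<open>E\<close> into its parts inside and outside \<open>D v\<close>
    is a bijection. The other \<open>D u\<close> are disjoint from \<open>D v\<close>, so hitting
    them depends on the outside part alone, and the sum factors.\<close>
  have "(\<Sum>E | E \<subseteq> B \<and> (\<forall>u\<in>insert v I. E \<inter> D u \<noteq> {}). w B E)
    = (\<Sum>(E, E')\<in>(Pow (D v) - {{}}) \<times> {E. E \<subseteq> B' \<and> (\<forall>v\<in>I. E \<inter> D v \<noteq> {})}. w (D v) E * w B' E')"
  proof (rule sum.reindex_bij_witness[where i = "\<lambda>(E, E'). E \<union> E'" and j = "\<lambda>E. (E \<inter> D v, E - D v)"])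
    fix E assume "E \<in> {E. E \<subseteq> B \<and> (\<forall>u\<in>insert v I. E \<inter> D u \<noteq> {})}"
    then have E: "E \<subseteq> B" "E \<inter> D v \<noteq> {}" "\<And>u. u \<in> I \<Longrightarrow> E \<inter> D u \<noteq> {}" by auto
    have "(E - D v) \<inter> D u \<noteq> {}" if "u \<in> I" for u
      using E(3)[OF that] disj[OF that] by blast
    then show "(E \<inter> D v, E - D v) \<in> (Pow (D v) - {{}}) \<times> {E. E \<subseteq> B' \<and> (\<forall>v\<in>I. E \<inter> D v \<noteq> {})}"
      using E unfolding B'_def by auto
    show "(case (E \<inter> D v, E - D v) of (E, E') \<Rightarrow> w (D v) E * w B' E') = w B E"
      using w_split[of "E \<inter> D v" "E - D v"] E(1) unfolding B'_def
      by (simp add: Int_Diff_Un Diff_mono)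
    show "(case (E \<inter> D v, E - D v) of (E, E') \<Rightarrow> E \<union> E') = E" by auto
  next
    fix b assume b: "b \<in> (Pow (D v) - {{}}) \<times> {E. E \<subseteq> B' \<and> (\<forall>v\<in>I. E \<inter> D v \<noteq> {})}"
    obtain E E' where b_eq: "b = (E, E')" by (cases b)
    then have EE: "b = (E, E')" "E \<subseteq> D v" "E \<noteq> {}" "E' \<subseteq> B'"
      "\<And>v. v \<in> I \<Longrightarrow> E' \<inter> D v \<noteq> {}" using b by simp_all
    show "((case b of (E, E') \<Rightarrow> E \<union> E') \<inter> D v, (case b of (E, E') \<Rightarrow> E \<union> E') - D v) = b"
    proof -
      have "(E \<union> E') \<inter> D v = E" "(E \<union> E') - D v = E'"
        using EE(2,4) unfolding B'_def by blast+
      then show ?thesis using EE(1) by simp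
    qed
    show "(case b of (E, E') \<Rightarrow> E \<union> E') \<in> {E. E \<subseteq> B \<and> (\<forall>u\<in>insert v I. E \<inter> D u \<noteq> {})}"
    proof -
      have "E \<union> E' \<subseteq> B" using EE(2,4) Dv(1) unfolding B'_def by blast
      moreover have "(E \<union> E') \<inter> D u \<noteq> {}" if "u \<in> insert v I" for u
        using that EE(2,3) EE(5)[of u] by blast
      ultimately show ?thesis using EE(1) by simp
    qed
  qed
  also have "\<dots> = (\<Sum>E\<in>Pow (D v) - {{}}. w (D v) E) *
      (\<Sum>E | E \<subseteq> B' \<and> (\<forall>v\<in>I. E \<inter> D v \<noteq> {}). w B' E)"
    by (simp add: sum_product sum.cartesian_product)
  finally show ?case using first IH insert.hyps by (simp add: w_def)
qed

text \<open>The binomial probability of its mean \<open>m\<close> is the largest one, and there are \<open>N + 1\<close> of them.\<close>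
lemma binomial_mode:
  fixes m N :: nat
  defines "p \<equiv> real m / real N"
  assumes "m < N"
  shows "1 \<le> real (Suc N) * (real (N choose m) * p ^ m * (1 - p) ^ (N - m))"
proof -
  define t where "t j = real (N choose j) * p ^ j * (1 - p) ^ (N - j)" for j
  have p: "p \<ge> 0" "p < 1" "p * N = m" using assms by (auto simp: p_def)
  have t0: "t j \<ge> 0" for j using p by (simp add: t_def)
  \<comment> \<open>The ratio of consecutive terms, cleared of denominators. As
    \<open>p * N = m\<close>, comparing the two factors amounts to comparing \<open>Suc j\<close>
    with \<open>m + p\<close>; since \<open>0 \<le> p < 1\<close>, the terms do not fall before
    \<open>m\<close> and do not rise after it.\<close>
  have rec: "t (Suc j) * (Suc j * (1 - p)) = t j * ((N - j) * p)" if "j < N" for j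
  proof -
    have "Suc j * (N choose Suc j) = (N - j) * (N choose j)"
      using binomial_absorption[of j N] binomial_absorb_comp[of N j] by simp
    then have "real (Suc j) * real (N choose Suc j) = real (N - j) * real (N choose j)"
      by (metis of_nat_mult)
    moreover have "(1 - p) ^ (N - j) = (1 - p) * (1 - p) ^ (N - Suc j)"
      using that by (metis Suc_diff_Suc power_Suc)
    ultimately show ?thesis by (simp add: t_def mult_ac)
  qed
  have up: "t j \<le> t (Suc j)" if "j < m" for j
  proof -
    have jN: "j < N" using that assms by simp
    have "real (Suc j) \<le> m" using that by simp
    then have "Suc j * (1 - p) \<le> (N - j) * p"
      using p jN by (simp add: of_nat_diff algebra_simps)
    then have "t j * (Suc j * (1 - p)) \<le> t (Suc j) * (Suc j * (1 - p))"
      unfolding rec[OF jN] using t0 by (intro mult_left_mono) auto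
    then show ?thesis using p by (simp add: mult_le_cancel_right)
  qed
  have down: "t (Suc j) \<le> t j" if "m \<le> j" "j < N" for j
  proof -
    have "real m \<le> j" using that by simp
    then have "(N - j) * p \<le> Suc j * (1 - p)"
      using p that by (simp add: of_nat_diff algebra_simps)
    then have "t (Suc j) * (Suc j * (1 - p)) \<le> t j * (Suc j * (1 - p))"
      unfolding rec[OF that(2)] using t0 by (intro mult_left_mono) auto
    then show ?thesis using p by (simp add: mult_le_cancel_right)
  qed
  have "t j \<le> t m" if "j \<le> N" for j
  proof (cases "j \<le> m")
    case True
    then show ?thesis using up by (induction j rule: inc_induct) (auto intro: order_trans)
  next
    case False
    then have "m \<le> j" by simp
    then show ?thesis using that
    proof (induction j rule: dec_induct)
      case (step i)
      then show ?case using down[of i] by simp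
    qed simp
  qed
  then have "(\<Sum>j\<le>N. t j) \<le> (\<Sum>j\<le>N. t m)" by (intro sum_mono) auto
  moreover have "(\<Sum>j\<le>N. t j) = (p + (1 - p)) ^ N" unfolding t_def by (rule binomial_ring[symmetric])
  ultimately show ?thesis by (simp add: t_def)
qed

text \<open>At density \<open>p = m / N\<close> all sets of size \<open>m\<close> have the same
  weight, and the hitting ones among them weigh at most as much as all hitting sets, whose weight is
  the product. By \<open>binomial_mode\<close>, fixing the size costs only the factor
  \<open>N + 1\<close>.\<close>

lemma card_subsets_hitting_le:
  fixes A :: "'a set"
  assumes "finite A" "finite I" "\<And>v. v \<in> I \<Longrightarrow> D v \<subseteq> A" "disjoint_family_on D I" "m < card A"
  shows "real (card {E. E \<subseteq> A \<and> card E = m \<and> (\<forall>v\<in>I. E \<inter> D v \<noteq> {})})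
    \<le> real (card A choose m) * real (Suc (card A)) *
      (\<Prod>v\<in>I. 1 - (1 - real m / real (card A)) ^ card (D v))"
    (is "real (card ?H) \<le> _")
proof -
  define N where "N = card A"
  define p where "p = real m / real N"
  define P where "P = (\<Prod>v\<in>I. 1 - (1 - p) ^ card (D v))"
  have p: "0 \<le> p" "p < 1" using assms by (auto simp: p_def N_def)
  have "real (card ?H) * (p ^ m * (1 - p) ^ (N - m)) = (\<Sum>E\<in>?H. p ^ m * (1 - p) ^ (N - m))"
    by simp
  also have "\<dots> = (\<Sum>E\<in>?H. p ^ card E * (1 - p) ^ card (A - E))"
    using assms(1) by (intro sum.cong) (auto simp: N_def card_Diff_subset finite_subset)
  also have "\<dots> \<le> (\<Sum>E | E \<subseteq> A \<and> (\<forall>v\<in>I. E \<inter> D v \<noteq> {}). p ^ card E * (1 - p) ^ card (A - E))"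
    using assms(1) p by (intro sum_mono2) auto
  also have "\<dots> = P" unfolding P_def using assms by (intro sum_hitting_weights) auto
  finally have le: "real (card ?H) * (p ^ m * (1 - p) ^ (N - m)) \<le> P" .
  have "real (card ?H) * 1 \<le> real (card ?H) * (real (Suc N) * (real (N choose m) * p ^ m * (1 - p) ^ (N - m)))"
    using binomial_mode[of m N] assms(5) unfolding p_def N_def by (intro mult_left_mono) auto
  also have "\<dots> = (real (N choose m) * real (Suc N)) * (real (card ?H) * (p ^ m * (1 - p) ^ (N - m)))"
    by (simp add: mult_ac)
  also have "\<dots> \<le> (real (N choose m) * real (Suc N)) * P"
    using le by (intro mult_left_mono) auto
  finally show ?thesis by (simp add: P_def p_def N_def)
qed

text \<open>The quotient of the two binomials is the product of \<open>(m - i) / (N - i)\<close>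
  over \<open>i < j\<close>, and each factor is at most \<open>m / N\<close> because
  \<open>m \<le> N\<close>.\<close>

lemma binomial_diff_le:
  assumes "j \<le> m" "m \<le> N"
  shows "real ((N - j) choose (m - j)) \<le> (real m / real N) ^ j * real (N choose m)"
  using assms(1)
proof (induction j)
  case 0
  then show ?case by simp
next
  case (Suc j)
  have "(N - j) * ((N - Suc j) choose (m - Suc j)) = (m - j) * ((N - j) choose (m - j))"
    using binomial_absorption[of "m - Suc j" "N - j"] Suc.prems assms(2)
    by (simp add: Suc_diff_Suc)
  then have "real (N - j) * real ((N - Suc j) choose (m - Suc j)) = real (m - j) * real ((N - j) choose (m - j))"
    by (metis of_nat_mult)
  moreover have "0 < real (N - j)" using Suc.prems assms(2) by simp
  ultimately have "real ((N - Suc j) choose (m - Suc j)) = real (m - j) / real (N - j) * real ((N - j) choose (m - j))"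
    by (simp add: field_simps)
  also have "real (m - j) / real (N - j) \<le> real m / real N"
    using Suc.prems assms(2) mult_left_mono[of "real m" "real N" "real j"] 
    by (simp add: of_nat_diff divide_simps algebra_simps)
  also have "real m / real N * real ((N - j) choose (m - j)) \<le> real m / real N * ((real m / real N) ^ j * real (N choose m))"
    using Suc by (intro mult_left_mono) auto
  finally show ?case by (simp add: mult_ac mult_right_mono)
qed

text \<open>Deleting \<open>F\<close> leaves a set of size \<open>m - card F\<close> in the
  complement of \<open>F\<close>, so each prescribed element costs a factor of at most
  \<open>m / N\<close>, as if elements were chosen independently.\<close>

lemma card_supersets_le:
  assumes "finite A" "F \<subseteq> A" "m \<le> card A"
  shows "real (card {E. E \<subseteq> A \<and> card E = m \<and> F \<subseteq> E})
    \<le> (real m / real (card A)) ^ card F * real (card A choose m)"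
proof (cases "card F \<le> m")
  case True
  have finF: "finite F" using assms finite_subset by blast
  have "card {E. E \<subseteq> A \<and> card E = m \<and> F \<subseteq> E} \<le> card {E. E \<subseteq> A - F \<and> card E = m - card F}"
  proof (rule card_inj_on_le[where f = "\<lambda>E. E - F"])
    show "inj_on (\<lambda>E. E - F) {E. E \<subseteq> A \<and> card E = m \<and> F \<subseteq> E}"
      by (rule inj_onI) blast
    show "(\<lambda>E. E - F) ` {E. E \<subseteq> A \<and> card E = m \<and> F \<subseteq> E} \<subseteq> {E. E \<subseteq> A - F \<and> card E = m - card F}"
      using finF by (auto simp: card_Diff_subset)
  qed (use assms(1) in auto)
  also have "\<dots> = (card A - card F) choose (m - card F)"
    using assms finF by (simp add: n_subsets card_Diff_subset)
  finally show ?thesis using binomial_diff_le[OF True assms(3)]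
    by (meson of_nat_le_iff order_trans)
next
  case False
  have "{E. E \<subseteq> A \<and> card E = m \<and> F \<subseteq> E} = {}"
    using False assms(1) by (auto dest: card_mono[rotated] finite_subset)
  then show ?thesis by (simp del: Collect_empty_eq)
qed

section \<open>Estimates for binomial coefficients\<close>

lemma power_le_exp_fact:
  fixes x :: real
  assumes "0 \<le> x"
  shows "x ^ n \<le> exp x * fact n"
proof -
  have "sum (\<lambda>k. x ^ k /\<^sub>R fact k) {n} \<le> exp x"
    unfolding exp_def using assms
    by (intro sum_le_suminf summable_exp_generic) auto
  then show ?thesis by (simp add: field_simps)
qed

text \<open>One term of the exponential series gives \<open>b ^ b \<le> exp b * fact b\<close>, and
  \<open>exp 1\<close> is rounded up to 3. The product form also covers
  \<open>b = 0\<close>.\<close>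

lemma binomial_mult_power_le: "real (a choose b) * real b ^ b \<le> (3 * real a) ^ b"
proof -
  have "real b ^ b \<le> exp (real b) * fact b" by (rule power_le_exp_fact) simp
  also have "exp (real b) \<le> 3 ^ b"
    using exp_le power_mono[of "exp 1" "3::real" b] by (simp flip: exp_of_nat_mult)
  finally have "real b ^ b \<le> 3 ^ b * fact b" by (simp add: mult_right_mono)
  then have "real (a choose b) * real b ^ b \<le> real (a choose b) * (3 ^ b * fact b)"
    by (intro mult_left_mono) auto
  also have "\<dots> = 3 ^ b * real ((a choose b) * fact b)" by simp
  also have "\<dots> \<le> 3 ^ b * real (a ^ b)"
    using binomial_fact_pow[of a b] by (intro mult_left_mono) (simp_all only: of_nat_le_iff zero_le_power zero_le_numeral)
  finally show ?thesis by (simp add: power_mult_distrib)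
qed

text \<open>A single term of the expansion of \<open>(\<kappa> + 1) ^ n\<close> is at most
  \<open>exp (n * \<kappa>)\<close>. Dividing by \<open>\<kappa> ^ k\<close> is worst at the largest
  admissible \<open>k\<close>, since \<open>- ln \<kappa> \<ge> 0\<close>.\<close>

lemma binomial_le_exp:
  fixes \<kappa> :: real
  assumes "0 < \<kappa>" "\<kappa> \<le> 1" "real k \<le> \<kappa> * real n"
  shows "real (n choose k) \<le> exp (real n * \<kappa> * (1 - ln \<kappa>))"
proof (cases "k \<le> n")
  case True
  have "real (n choose k) * \<kappa> ^ k \<le> (\<Sum>j\<le>n. real (n choose j) * \<kappa> ^ j * 1 ^ (n - j))"
    using True assms(1) member_le_sum[of k "{..n}" "\<lambda>j. real (n choose j) * \<kappa> ^ j"] by auto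
  also have "\<dots> = (\<kappa> + 1) ^ n" by (rule binomial_ring[symmetric])
  also have "\<dots> \<le> exp \<kappa> ^ n"
    using assms(1) exp_ge_add_one_self[of \<kappa>] by (intro power_mono) (auto simp: add.commute)
  finally have "real (n choose k) * exp (k * ln \<kappa>) \<le> exp (n * \<kappa>)"
    using assms(1) by (simp add: exp_of_nat_mult)
  then have "real (n choose k) \<le> exp (n * \<kappa> - k * ln \<kappa>)"
    by (simp add: exp_diff field_simps)
  also have "\<dots> \<le> exp (real n * \<kappa> * (1 - ln \<kappa>))"
    using mult_right_mono[OF assms(3), of "- ln \<kappa>"] assms(1,2) by (simp add: algebra_simps)
  finally show ?thesis .
qed (simp add: binomial_eq_0)

section \<open>Counting graphs with a dominating set or a dense pair\<close>

lemma finite_all_edges: "finite (all_edges n)"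
  unfolding all_edges_def by (rule finite_subset[of _ "Pow {1..n}"]) auto

lemma card_all_edges: "card (all_edges n) = n choose 2"
  unfolding all_edges_def by (simp add: n_subsets)

lemma finite_gnm_graphs: "finite (gnm_graphs n m)"
  unfolding gnm_graphs_def by (rule finite_subset[of _ "Pow (all_edges n)"]) (auto simp: finite_all_edges)

lemma card_gnm_graphs: "card (gnm_graphs n m) = (n choose 2) choose m"
  unfolding gnm_graphs_def by (simp add: n_subsets finite_all_edges card_all_edges)

lemma card_UN_le_mult:
  fixes c :: real
  assumes "finite I" "\<And>i. i \<in> I \<Longrightarrow> real (card (F i)) \<le> c"
  shows "real (card (\<Union>i\<in>I. F i)) \<le> real (card I) * c"
proof -
  have "real (card (\<Union>i\<in>I. F i)) \<le> (\<Sum>i\<in>I. real (card (F i)))"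
    using card_UN_le[OF assms(1), of F] by (metis of_nat_le_iff of_nat_sum)
  also have "\<dots> \<le> real (card I) * c" using assms(2) by (rule sum_bounded_above)
  finally show ?thesis .
qed

definition dominates :: "nat \<Rightarrow> nat set set \<Rightarrow> nat set \<Rightarrow> bool" where
  "dominates n E S \<longleftrightarrow> (\<forall>v\<in>{1..n} - S. \<exists>u\<in>S. {u, v} \<in> E)"

text \<open>For disjoint \<open>A\<close> and \<open>B\<close> these are the edges of the complete
  bipartite graph, as two-element sets, so that intersecting with \<open>E\<close> gives the edges
  of \<open>E\<close> between them.\<close>

definition crossing :: "'a set \<Rightarrow> 'a set \<Rightarrow> 'a set set" where
  "crossing A B = (\<lambda>(a, b). {a, b}) ` (A \<times> B)"

lemma inj_on_crossing: "A \<inter> B = {} \<Longrightarrow> inj_on (\<lambda>(a, b). {a, b}) (A \<times> B)"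
  by (auto simp: inj_on_def doubleton_eq_iff)

lemma card_crossing: "A \<inter> B = {} \<Longrightarrow> card (crossing A B) = card A * card B"
  unfolding crossing_def by (simp add: card_image inj_on_crossing card_cartesian_product)

lemma crossing_subset_all_edges:
  "A \<subseteq> {1..n} \<Longrightarrow> B \<subseteq> {1..n} \<Longrightarrow> A \<inter> B = {} \<Longrightarrow> crossing A B \<subseteq> all_edges n"
  unfolding crossing_def all_edges_def by (auto simp: card_insert_if)

text \<open>\<open>D v\<close> collects the \<open>k\<close> potential edges from \<open>v\<close>
  to \<open>S\<close>. These stars are disjoint for distinct \<open>v\<close> outside
  \<open>S\<close>, and domination means that \<open>E\<close> hits all \<open>n - k\<close> of
  them.\<close>

lemma card_dominated_graphs_le:
  assumes S: "S \<subseteq> {1..n}" "card S = k" and m: "m < n choose 2"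
  shows "real (card {E \<in> gnm_graphs n m. dominates n E S})
    \<le> real ((n choose 2) choose m) * real (Suc (n choose 2)) *
      (1 - (1 - real m / real (n choose 2)) ^ k) ^ (n - k)"
proof -
  define D where "D v = (\<lambda>u. {u, v}) ` S" for v
  have fin: "finite S" using S(1) finite_subset by blast
  have D: "D v \<subseteq> all_edges n" "card (D v) = k" if "v \<in> {1..n} - S" for v
  proof -
    show "D v \<subseteq> all_edges n" using that S(1) by (fastforce simp: D_def all_edges_def card_2_iff)
    have "inj_on (\<lambda>u. {u, v}) S" by (auto simp: inj_on_def doubleton_eq_iff)
    then show "card (D v) = k" using S(2) by (simp add: D_def card_image)
  qed
  have disj: "disjoint_family_on D ({1..n} - S)"
    unfolding disjoint_family_on_def D_def by (auto simp: doubleton_eq_iff)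
  have eq: "{E \<in> gnm_graphs n m. dominates n E S}
      = {E. E \<subseteq> all_edges n \<and> card E = m \<and> (\<forall>v\<in>{1..n} - S. E \<inter> D v \<noteq> {})}"
    unfolding gnm_graphs_def dominates_def D_def by blast
  have "(\<Prod>v\<in>{1..n} - S. 1 - (1 - real m / real (card (all_edges n))) ^ card (D v))
      = (1 - (1 - real m / real (n choose 2)) ^ k) ^ (n - k)"
    using D(2) S fin by (simp add: card_all_edges card_Diff_subset)
  then show ?thesis
    using card_subsets_hitting_le[OF finite_all_edges _ D(1) disj, of m] m
    unfolding eq by (simp add: card_all_edges)
qed

lemma card_some_dominated_le:
  assumes m: "m < n choose 2"
  shows "real (card {E \<in> gnm_graphs n m. \<exists>S\<subseteq>{1..n}. card S = k \<and> dominates n E S})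
    \<le> real (n choose k) * (real ((n choose 2) choose m) * real (Suc (n choose 2)) *
      (1 - (1 - real m / real (n choose 2)) ^ k) ^ (n - k))"
proof -
  let ?T = "{S. S \<subseteq> {1..n} \<and> card S = k}"
  have "{E \<in> gnm_graphs n m. \<exists>S\<subseteq>{1..n}. card S = k \<and> dominates n E S}
    = (\<Union>S\<in>?T. {E \<in> gnm_graphs n m. dominates n E S})"
    by auto
  also have "real (card \<dots>) \<le> real (card ?T) * (real ((n choose 2) choose m) * real (Suc (n choose 2)) *
      (1 - (1 - real m / real (n choose 2)) ^ k) ^ (n - k))"
  proof (rule card_UN_le_mult)
    fix S assume "S \<in> ?T"
    then have "S \<subseteq> {1..n}" "card S = k" by simp_all
    then show "real (card {E \<in> gnm_graphs n m. dominates n E S})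
      \<le> real ((n choose 2) choose m) * real (Suc (n choose 2)) *
      (1 - (1 - real m / real (n choose 2)) ^ k) ^ (n - k)"
      by (rule card_dominated_graphs_le[OF _ _ m])
  qed simp
  also have "card ?T = n choose k" by (simp add: n_subsets)
  finally show ?thesis .
qed

text \<open>Union bound over the \<open>j\<close>-element sets \<open>F\<close> among the
  \<open>s * s\<close> potential crossing edges: a graph with at least \<open>j\<close> crossing
  edges contains some \<open>F\<close>.\<close>

lemma card_dense_pair_le:
  assumes AB: "A \<subseteq> {1..n}" "B \<subseteq> {1..n}" "A \<inter> B = {}" "card A = s" "card B = s"
    and m: "m \<le> n choose 2"
  shows "real (card {E \<in> gnm_graphs n m. j \<le> card (E \<inter> crossing A B)})
    \<le> real (s * s choose j) * ((real m / real (n choose 2)) ^ j * real ((n choose 2) choose m))"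
proof -
  let ?F = "{F. F \<subseteq> crossing A B \<and> card F = j}"
  have sub: "crossing A B \<subseteq> all_edges n" using AB by (intro crossing_subset_all_edges)
  then have fin: "finite (crossing A B)" using finite_all_edges finite_subset by blast
  have "{E \<in> gnm_graphs n m. j \<le> card (E \<inter> crossing A B)}
    \<subseteq> (\<Union>F\<in>?F. {E. E \<subseteq> all_edges n \<and> card E = m \<and> F \<subseteq> E})"
  proof
    fix E assume E: "E \<in> {E \<in> gnm_graphs n m. j \<le> card (E \<inter> crossing A B)}"
    then obtain F where "F \<subseteq> E \<inter> crossing A B" "card F = j"
      by (auto elim: obtain_subset_with_card_n)
    then show "E \<in> (\<Union>F\<in>?F. {E. E \<subseteq> all_edges n \<and> card E = m \<and> F \<subseteq> E})"
      using E by (auto simp: gnm_graphs_def)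
  qed
  then have "real (card {E \<in> gnm_graphs n m. j \<le> card (E \<inter> crossing A B)})
    \<le> real (card (\<Union>F\<in>?F. {E. E \<subseteq> all_edges n \<and> card E = m \<and> F \<subseteq> E}))"
    using fin by (intro of_nat_mono card_mono) (auto simp: finite_all_edges)
  also have "\<dots> \<le> real (card ?F) * ((real m / real (n choose 2)) ^ j * real ((n choose 2) choose m))"
    using card_supersets_le[OF finite_all_edges, of _ n m] sub m fin
    by (intro card_UN_le_mult) (auto simp: card_all_edges)
  also have "card ?F = s * s choose j"
    using fin AB by (simp add: n_subsets card_crossing)
  finally show ?thesis .
qed

lemma card_some_dense_pair_le:
  assumes m: "m \<le> n choose 2"
  shows "real (card {E \<in> gnm_graphs n m. \<exists>A\<subseteq>{1..n}. \<exists>B\<subseteq>{1..n}.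
      A \<inter> B = {} \<and> card A = s \<and> card B = s \<and> j \<le> card (E \<inter> crossing A B)})
    \<le> real (n choose s) ^ 2 * (real (s * s choose j) *
      ((real m / real (n choose 2)) ^ j * real ((n choose 2) choose m)))"
    (is "real (card ?L) \<le> _ * ?c")
proof -
  let ?T = "{A. A \<subseteq> {1..n} \<and> card A = s}"
  let ?P = "{(A, B) \<in> ?T \<times> ?T. A \<inter> B = {}}"
  have finT: "finite ?T" by simp
  have sub: "?P \<subseteq> ?T \<times> ?T" by blast
  have finTT: "finite (?T \<times> ?T)" using finT by (rule finite_cartesian_product[OF _ finT])
  then have fin: "finite ?P" by (rule finite_subset[OF sub])
  have "card ?P \<le> card (?T \<times> ?T)" by (rule card_mono[OF finTT sub])
  also have "\<dots> = (n choose s) ^ 2"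
    by (simp add: n_subsets card_cartesian_product power2_eq_square)
  finally have cardP: "real (card ?P) \<le> real (n choose s) ^ 2"
    by (simp flip: of_nat_power)
  have L_eq: "?L = (\<Union>(A, B)\<in>?P. {E \<in> gnm_graphs n m. j \<le> card (E \<inter> crossing A B)})"
    by auto
  have "real (card ?L) \<le> real (card ?P) * ?c"
    unfolding L_eq using fin
    by (rule card_UN_le_mult) (clarsimp, intro card_dense_pair_le[OF _ _ _ _ _ m], simp_all)
  also have "\<dots> \<le> real (n choose s) ^ 2 * ?c"
    using cardP by (rule mult_right_mono) simp
  finally show ?thesis .
qed

section \<open>Probability of the two bad events\<close>

text \<open>With \<open>y = s / n\<close>, choosing the two sets costs at most
  \<open>(3 / y) ^ (2 * s)\<close>, against a factor
  \<open>(6 * d / \<Delta> * y) ^ (\<Delta> * s)\<close> for the edges. A bound of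
  \<open>1 / n ^ 2\<close> leaves \<open>1 / n\<close> after summing over
  \<open>s \<le> n\<close>.\<close>

lemma dense_pair_bound:
  fixes d :: real
  assumes d: "d > 0" "12 * d \<le> real \<Delta>" "6 \<le> \<Delta>" and n: "2 \<le> n" and s: "1 \<le> s" "s \<le> n"
    and m: "real m \<le> d * real n / 2"
  shows "real (n choose s) ^ 2 * (real (s * s choose (\<Delta> * s)) * (real m / real (n choose 2)) ^ (\<Delta> * s))
    \<le> 1 / real n ^ 2"
proof -
  define y where "y = real s / real n"
  have y: "0 < y" "y \<le> 1" using s n by (auto simp: y_def)
  have pos: "0 < real s" "0 < real n" "0 < real \<Delta>" using s n d by auto
  have "real (n choose 2) = real n * (real n - 1) / 2"
    using n by (simp add: choose_two real_of_nat_div of_nat_diff)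
  moreover have "real n * (real n / 2) \<le> real n * (real n - 1)"
    using n by (intro mult_left_mono) auto
  ultimately have N: "real n * real n / 4 \<le> real (n choose 2)" by simp
  \<comment> \<open>The value \<open>2 * d / n\<close> is twice the asymptotic bound on the edge
    density; this slack makes the estimate valid from \<open>n = 2\<close> on.\<close>
  have "real m / real (n choose 2) \<le> (d * real n / 2) / (real n * real n / 4)"
    using m N pos d by (intro frac_le) auto
  also have "\<dots> = 2 * d / real n" using pos by (simp add: field_simps)
  finally have p: "real m / real (n choose 2) \<le> 2 * d / real n" .
  have "real (n choose s) \<le> (3 * real n / real s) ^ s"
    using binomial_mult_power_le[of n s] pos by (simp add: power_divide field_simps)
  also have "3 * real n / real s = 3 / y" by (simp add: y_def)
  finally have c1: "real (n choose s) \<le> (3 / y) ^ s" .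
  have "real (s * s choose (\<Delta> * s)) \<le> (3 * real (s * s) / real (\<Delta> * s)) ^ (\<Delta> * s)"
    using binomial_mult_power_le[of "s * s" "\<Delta> * s"] pos
    unfolding power_divide by (subst pos_le_divide_eq) auto
  also have "3 * real (s * s) / real (\<Delta> * s) = 3 * real s / real \<Delta>"
    using pos by simp
  finally have c2: "real (s * s choose (\<Delta> * s)) \<le> (3 * real s / real \<Delta>) ^ (\<Delta> * s)" .
  have "real (s * s choose (\<Delta> * s)) * (real m / real (n choose 2)) ^ (\<Delta> * s)
    \<le> (3 * real s / real \<Delta>) ^ (\<Delta> * s) * (2 * d / real n) ^ (\<Delta> * s)"
    using c2 p by (intro mult_mono power_mono) auto
  also have "\<dots> = (6 * d / real \<Delta> * y) ^ (\<Delta> * s)"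
    by (simp add: y_def mult_ac flip: power_mult_distrib)
  also have "\<dots> \<le> (1 / 2 * y) ^ (\<Delta> * s)"
    using d y pos by (intro power_mono mult_right_mono) (auto simp: field_simps)
  \<comment> \<open>The base is at most 1, and exponent 6 is enough: \<open>y ^ 6\<close> outweighs
    the \<open>1 / y ^ 2\<close> from the choice of two sets.\<close>
  also have "\<dots> \<le> (1 / 2 * y) ^ (6 * s)"
    using y d by (intro power_decreasing) auto
  finally have "real (n choose s) ^ 2 * (real (s * s choose (\<Delta> * s)) * (real m / real (n choose 2)) ^ (\<Delta> * s))
    \<le> ((3 / y) ^ s) ^ 2 * (1 / 2 * y) ^ (6 * s)"
    using c1 by (intro mult_mono power_mono) auto
  also have "\<dots> = ((3 / y) ^ 2 * (1 / 2 * y) ^ 6) ^ s"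
  proof -
    have "((3 / y) ^ s) ^ 2 = ((3 / y) ^ 2) ^ s"
      by (simp only: power_mult[symmetric] mult.commute)
    then show ?thesis by (simp only: power_mult_distrib power_mult)
  qed
  also have "(3 / y) ^ 2 * (1 / 2 * y) ^ 6 = 9 / 64 * y ^ 4"
    using y by (simp add: field_simps power_numeral_reduce)
  \<comment> \<open>Weakened to this shape so that a single \<open>y ^ 2 = s ^ 2 / n ^ 2\<close>
    supplies the factor \<open>1 / n ^ 2\<close>, while \<open>4 ^ s\<close> absorbs
    \<open>s ^ 2\<close>.\<close>
  also have "\<dots> \<le> 1 / 4 * y ^ 2"
    using y power_decreasing[of 2 4 y] by (intro mult_mono) auto
  then have "(9 / 64 * y ^ 4) ^ s \<le> (1 / 4 * y ^ 2) ^ s"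
    using y by (intro power_mono) auto
  also have "\<dots> = (1 / 4) ^ s * (y ^ 2) ^ s" by (simp only: power_mult_distrib)
  also have "\<dots> \<le> (1 / 4) ^ s * (y ^ 2) ^ 1"
    using y s by (intro mult_left_mono power_decreasing) (auto simp: power_le_one)
  also have "\<dots> = real s ^ 2 / 4 ^ s * (1 / real n ^ 2)"
    by (simp add: y_def power_divide)
  also have "\<dots> \<le> 1 * (1 / real n ^ 2)"
  proof (intro mult_right_mono)
    have "real s ^ 2 \<le> (2 ^ s) ^ 2"
      using of_nat_less_two_power[of s, where 'a = real] by (intro power_mono) auto
    also have "\<dots> = (4 :: real) ^ s" by (simp add: power2_eq_square flip: power_mult_distrib)
    finally show "real s ^ 2 / 4 ^ s \<le> 1" by simp
  qed simp
  finally show ?thesis by simp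
qed

text \<open>A smaller set extends to one of size exactly \<open>k\<close>, and a vertex that the
  larger set leaves undominated is free for the smaller one. If every \<open>t\<close> in
  \<open>A\<close> had more than \<open>\<Delta>\<close> neighbours in \<open>B\<close>, counting
  edges by their endpoint in \<open>A\<close> would produce a dense pair.\<close>

lemma gamma_connected_if_not_bad:
  assumes E: "E \<in> gnm_graphs n m" and k: "k \<le> n"
    and dom: "\<not> (\<exists>S\<subseteq>{1..n}. card S = k \<and> dominates n E S)"
    and dense: "\<And>s. s \<in> {1..n} \<Longrightarrow> \<not> (\<exists>A\<subseteq>{1..n}. \<exists>B\<subseteq>{1..n}.
      A \<inter> B = {} \<and> card A = s \<and> card B = s \<and> \<Delta> * s \<le> card (E \<inter> crossing A B))"
  shows "gamma_connected (2 * Suc \<Delta>) (indep_sets n E k)"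
proof (rule gamma_connected_indep_sets)
  show "E \<subseteq> all_edges n" using E by (simp add: gnm_graphs_def)
  fix S assume S: "S \<subseteq> {1..n}" "card S < k"
  obtain S' where "S \<subseteq> S'" "S' \<subseteq> {1..n}" "card S' = k"
    using exists_subset_between[of S k "{1..n}"] S k by auto
  then show "\<exists>v\<in>{1..n} - S. \<forall>u\<in>S. {u, v} \<notin> E"
    using dom unfolding dominates_def by blast
next
  have finE: "finite E"
    using E finite_all_edges finite_subset unfolding gnm_graphs_def by blast
  fix A B assume AB: "A \<subseteq> {1..n}" "B \<subseteq> {1..n}" "A \<inter> B = {}" "card A = card B" "A \<noteq> {}"
  have fin: "finite A" "finite B" using AB finite_subset by blast+
  show "\<exists>t\<in>A. card {u\<in>B. {u, t} \<in> E} \<le> \<Delta>"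
  proof (rule ccontr)
    assume "\<not> ?thesis"
    then have "\<Delta> * card A \<le> (\<Sum>t\<in>A. card {u\<in>B. {u, t} \<in> E})"
      using sum_bounded_below[of A \<Delta> "\<lambda>t. card {u\<in>B. {u, t} \<in> E}"] by (simp add: mult.commute not_le less_imp_le)
    also have "\<dots> = card (SIGMA t:A. {u\<in>B. {u, t} \<in> E})"
      using fin by simp
    also have "\<dots> \<le> card (E \<inter> crossing A B)"
    proof (rule card_inj_on_le)
      show "inj_on (\<lambda>(a, b). {a, b}) (SIGMA t:A. {u\<in>B. {u, t} \<in> E})"
        by (rule inj_on_subset[OF inj_on_crossing[OF AB(3)]]) auto
      show "(\<lambda>(a, b). {a, b}) ` (SIGMA t:A. {u\<in>B. {u, t} \<in> E}) \<subseteq> E \<inter> crossing A B"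
        unfolding crossing_def by (auto simp: insert_commute)
    qed (use finE in simp)
    finally have "\<Delta> * card A \<le> card (E \<inter> crossing A B)" .
    moreover have "card A \<in> {1..n}"
      using AB(1,5) fin card_mono[OF _ AB(1)] by (auto simp: Suc_le_eq card_gt_0_iff)
    ultimately show False using dense[of "card A"] AB by auto
  qed
qed

text \<open>Union bound: the first subtracted term accounts for dominating sets of size
  \<open>k\<close>, and \<open>1 / n\<close> for dense pairs of all sizes
  \<open>s \<le> n\<close>.\<close>

theorem prob_gamma_connected_ge:
  fixes d :: real
  assumes d: "d > 0" "12 * d \<le> real \<Delta>" "6 \<le> \<Delta>" and n: "2 \<le> n" and k: "k \<le> n"
    and m: "real m \<le> d * real n / 2" "m < n choose 2"
  shows "measure_pmf.prob (Gnm n m) {E. gamma_connected (2 * Suc \<Delta>) (indep_sets n E k)}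
    \<ge> 1 - real (n choose k) * real (Suc (n choose 2)) *
        (1 - (1 - real m / real (n choose 2)) ^ k) ^ (n - k) - 1 / real n"
    (is "_ \<ge> 1 - ?p1 - _")
proof -
  define C where "C = real ((n choose 2) choose m)"
  have C: "C > 0" using m(2) by (simp add: C_def)
  let ?G = "gnm_graphs n m"
  let ?good = "{E. gamma_connected (2 * Suc \<Delta>) (indep_sets n E k)}"
  let ?bad1 = "{E \<in> ?G. \<exists>S\<subseteq>{1..n}. card S = k \<and> dominates n E S}"
  let ?bad2 = "\<lambda>s. {E \<in> ?G. \<exists>A\<subseteq>{1..n}. \<exists>B\<subseteq>{1..n}.
      A \<inter> B = {} \<and> card A = s \<and> card B = s \<and> \<Delta> * s \<le> card (E \<inter> crossing A B)}"
  have cG: "real (card ?G) = C" by (simp add: card_gnm_graphs C_def)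
  then have ne: "?G \<noteq> {}" using C by auto
  have "?G \<subseteq> (?G \<inter> ?good) \<union> (?bad1 \<union> (\<Union>s\<in>{1..n}. ?bad2 s))"
  proof
    fix E assume E: "E \<in> ?G"
    show "E \<in> (?G \<inter> ?good) \<union> (?bad1 \<union> (\<Union>s\<in>{1..n}. ?bad2 s))"
    proof (cases "E \<in> ?bad1 \<union> (\<Union>s\<in>{1..n}. ?bad2 s)")
      case False
      have "gamma_connected (2 * Suc \<Delta>) (indep_sets n E k)"
        by (rule gamma_connected_if_not_bad[OF E k]) (use E False in blast)+
      then show ?thesis using E by blast
    qed blast
  qed
  then have "card ?G \<le> card ((?G \<inter> ?good) \<union> (?bad1 \<union> (\<Union>s\<in>{1..n}. ?bad2 s)))"
    using finite_gnm_graphs by (intro card_mono) auto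
  also have "\<dots> \<le> card (?G \<inter> ?good) + (card ?bad1 + card (\<Union>s\<in>{1..n}. ?bad2 s))"
    by (intro order_trans[OF card_Un_le] add_mono card_Un_le order_refl)
  finally have split: "C \<le> real (card (?G \<inter> ?good)) + (real (card ?bad1) + real (card (\<Union>s\<in>{1..n}. ?bad2 s)))"
    unfolding cG[symmetric] by linarith
  have b1: "real (card ?bad1) \<le> ?p1 * C"
    using card_some_dominated_le[OF m(2), of k] by (simp add: C_def mult_ac)
  have "real (card (?bad2 s)) \<le> 1 / real n ^ 2 * C" if "s \<in> {1..n}" for s
  proof -
    have "real (card (?bad2 s)) \<le> real (n choose s) ^ 2 * (real (s * s choose (\<Delta> * s)) *
      ((real m / real (n choose 2)) ^ (\<Delta> * s) * C))"
      unfolding C_def using m(2) by (intro card_some_dense_pair_le) simp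
    also have "\<dots> = real (n choose s) ^ 2 * (real (s * s choose (\<Delta> * s)) * (real m / real (n choose 2)) ^ (\<Delta> * s)) * C"
      by (simp add: mult_ac)
    also have "\<dots> \<le> 1 / real n ^ 2 * C"
      using C d n m(1) that by (intro mult_right_mono dense_pair_bound) auto
    finally show ?thesis .
  qed
  then have "real (card (\<Union>s\<in>{1..n}. ?bad2 s)) \<le> real (card {1..n}) * (1 / real n ^ 2 * C)"
    by (intro card_UN_le_mult) auto
  then have b2: "real (card (\<Union>s\<in>{1..n}. ?bad2 s)) \<le> 1 / real n * C"
    using n by (simp add: power2_eq_square)
  have "measure_pmf.prob (Gnm n m) ?good = real (card (?G \<inter> ?good)) / C"
    unfolding Gnm_def by (simp add: measure_pmf_of_set finite_gnm_graphs ne flip: cG)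
  moreover have "(1 - ?p1 - 1 / real n) * C \<le> real (card (?G \<inter> ?good))"
    using split b1 b2 by (simp add: algebra_simps)
  ultimately show ?thesis using C by (simp add: pos_le_divide_eq)
qed

section \<open>Limits as \<open>n\<close> grows\<close>

lemma gamma_connected_indep_sets_0: "gamma_connected \<gamma> (indep_sets n E 0)"
proof -
  have "\<sigma> = {}" if "\<sigma> \<in> indep_sets n E 0" for \<sigma>
    using that finite_subset[of \<sigma> "{1..n}"] by (auto simp: indep_sets_def)
  then show ?thesis
    by (intro gamma_connectedI[where \<mu> = "\<lambda>_ _. 0"]) blast
qed

text \<open>\<open>exp (- c * d)\<close> is the limiting probability that a vertex has no neighbour
  in a set of size \<open>c * n\<close> at edge density \<open>d / (n - 1)\<close>. In units of
  \<open>n * ln d ^ 2 / d\<close>, the choice of the set contributes at most 2 to the exponent and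
  domination at most -3; the surplus beats the factor \<open>n ^ 2\<close>.\<close>

lemma domination_bound_tendsto_0:
  fixes d c :: real and k m :: "nat \<Rightarrow> nat"
  assumes d: "d \<ge> 3" and c: "0 \<le> c" "c \<le> ln d / d" "exp (- c * d) = 12 * ln d ^ 2 / d"
    and k: "\<And>n. real (k n) \<le> c * real n" and m: "\<And>n. real (m n) \<le> d * real n / 2"
  shows "(\<lambda>n. real (n choose k n) * real (Suc (n choose 2)) *
        (1 - (1 - real (m n) / real (n choose 2)) ^ k n) ^ (n - k n)) \<longlonglongrightarrow> 0"
    (is "?f \<longlonglongrightarrow> 0")
proof -
  define \<kappa> where "\<kappa> = ln d / d"
  \<comment> \<open>Half of the limit \<open>exp (- c * d)\<close>, hence eventually a lower bound
    for the probability at finite \<open>n\<close>.\<close>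
  define \<theta> where "\<theta> = 6 * ln d ^ 2 / d"
  have "exp 1 \<le> d" using exp_le d by linarith
  then have ln1: "1 \<le> ln d" using d by (subst ln_ge_iff) auto
  \<comment> \<open>This leads to \<open>\<kappa> \<le> 1 / 2\<close>, so at least half of the
    vertices lie outside a set of size \<open>k n\<close>.\<close>
  have "ln (d / 2) \<le> d / 2 - 1" using d by (intro ln_le_minus_one) auto
  moreover have "ln 2 \<le> (1::real)" using ln_le_minus_one[of "2::real"] by simp
  ultimately have "ln d \<le> d / 2" using d by (simp add: ln_div)
  then have \<kappa>: "0 < \<kappa>" "\<kappa> \<le> 1 / 2" using d ln1 by (auto simp: \<kappa>_def field_simps)
  have "ln \<kappa> = ln (ln d) - ln d" using d ln1 by (simp add: \<kappa>_def ln_div)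
  then have \<kappa>ln: "1 - ln \<kappa> \<le> 2 * ln d" using ln1 ln_ge_zero[OF ln1] by linarith
  have "\<theta> < exp (- c * d)" using d ln1 unfolding c(3) \<theta>_def by (intro divide_strict_right_mono) auto
  moreover have "((\<lambda>n. (1 - d / (real n - 1)) powr (c * real n)) \<longlongrightarrow> exp (- c * d)) at_top"
    using d by real_asymp
  ultimately have "\<forall>\<^sub>F n in at_top. \<theta> < (1 - d / (real n - 1)) powr (c * real n)"
    by (rule order_tendstoD(1)[rotated])
  moreover have "\<forall>\<^sub>F n in at_top. real n > d + 1" by real_asymp
  ultimately have "\<forall>\<^sub>F n in at_top. norm (?f n) \<le> real n ^ 2 * exp (- (ln d ^ 2 / d * real n))"
  proof eventually_elim
    case (elim n)
    have n: "4 < real n" using elim d by linarith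
    define p where "p = real (m n) / real (n choose 2)"
    have N: "real (n choose 2) = real n * (real n - 1) / 2"
      using n by (simp add: choose_two real_of_nat_div of_nat_diff)
    have "p \<le> (d * real n / 2) / real (n choose 2)"
      unfolding p_def using m[of n] by (intro divide_right_mono) auto
    also have "\<dots> = d / (real n - 1)" using n by (simp add: N field_simps)
    finally have p: "p \<le> d / (real n - 1)" "0 \<le> p" by (auto simp: p_def)
    have base: "0 < 1 - d / (real n - 1)" "1 - d / (real n - 1) \<le> 1" using elim d by auto
    have "\<theta> \<le> (1 - d / (real n - 1)) powr (c * real n)" using elim by simp
    \<comment> \<open>The base lies between 0 and 1, so smaller sets only leave more vertices free;
      all admissible \<open>k n\<close> reduce to \<open>c * n\<close>.\<close>
    also have "\<dots> \<le> (1 - d / (real n - 1)) powr real (k n)"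
      using k[of n] base by (intro powr_mono') auto
    also have "\<dots> = (1 - d / (real n - 1)) ^ k n" using base by (simp add: powr_realpow)
    also have "\<dots> \<le> (1 - p) ^ k n" using p base by (intro power_mono) auto
    finally have \<theta>: "\<theta> \<le> (1 - p) ^ k n" .
    have pk: "(1 - p) ^ k n \<le> 1" using p base by (intro power_le_one) auto
    have kn: "real (k n) \<le> \<kappa> * real n"
      using k[of n] mult_right_mono[OF c(2), of "real n"] by (simp add: \<kappa>_def)
    also have "\<dots> \<le> 1 / 2 * real n" using \<kappa> by (intro mult_right_mono) auto
    finally have half: "real n / 2 \<le> real (n - k n)" by linarith
    have \<theta>0: "0 \<le> \<theta>" using d by (simp add: \<theta>_def)
    have "(1 - (1 - p) ^ k n) ^ (n - k n) \<le> (1 - \<theta>) ^ (n - k n)"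
      using \<theta> pk by (intro power_mono) auto
    also have "\<dots> \<le> exp (- \<theta>) ^ (n - k n)"
      using exp_ge_add_one_self[of "- \<theta>"] \<theta> pk by (intro power_mono) auto
    also have "\<dots> = exp (- (real (n - k n) * \<theta>))" by (simp flip: exp_of_nat_mult)
    also have "\<dots> \<le> exp (- (real n / 2 * \<theta>))"
      using mult_right_mono[OF half \<theta>0] by simp
    finally have pow: "(1 - (1 - p) ^ k n) ^ (n - k n) \<le> exp (- (real n / 2 * \<theta>))" .
    have "real (n choose k n) \<le> exp (real n * \<kappa> * (1 - ln \<kappa>))"
      using \<kappa> kn by (intro binomial_le_exp) auto
    also have "\<dots> \<le> exp (real n * \<kappa> * (2 * ln d))"
      using \<kappa> \<kappa>ln by (auto intro!: mult_left_mono)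
    finally have bin: "real (n choose k n) \<le> exp (real n * \<kappa> * (2 * ln d))" .
    have "4 * 4 \<le> real n * real n" using n by (intro mult_mono) auto
    moreover have "real n * (real n - 1) \<le> real n * real n" by (intro mult_left_mono) auto
    ultimately have "real n * (real n - 1) / 2 + 1 \<le> real n * real n" by simp
    then have Suc: "real (Suc (n choose 2)) \<le> real n ^ 2"
      by (simp add: N power2_eq_square)
    have "?f n \<le> exp (real n * \<kappa> * (2 * ln d)) * real n ^ 2 * exp (- (real n / 2 * \<theta>))"
      using bin Suc pow pk unfolding p_def[symmetric] by (intro mult_mono) auto
    also have "\<dots> = real n ^ 2 * exp (real n * \<kappa> * (2 * ln d) + - (real n / 2 * \<theta>))"
      unfolding exp_add by simp
    also have "real n * \<kappa> * (2 * ln d) + - (real n / 2 * \<theta>) = - (ln d ^ 2 / d * real n)"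
      by (simp add: \<kappa>_def \<theta>_def power2_eq_square field_simps)
    finally have "?f n \<le> real n ^ 2 * exp (- (ln d ^ 2 / d * real n))" .
    moreover have "0 \<le> ?f n" using pk unfolding p_def[symmetric] by auto
    ultimately show ?case by simp
  qed
  moreover have "(\<lambda>n. real n ^ 2 * exp (- (ln d ^ 2 / d * real n))) \<longlonglongrightarrow> 0"
  proof -
    have "(\<lambda>n. real n ^ 2 * exp (- (a * real n))) \<longlonglongrightarrow> 0" if "0 < a" for a :: real
      using that by real_asymp
    moreover have "0 < ln d ^ 2 / d" using d ln1 by auto
    ultimately show ?thesis .
  qed
  ultimately show ?thesis by (rule Lim_null_comparison)
qed

text \<open>The edge number is \<open>d * n / 2\<close> rounded down. \<open>\<gamma>\<close> is
  fixed before the sequence \<open>k\<close>, so it depends on \<open>d\<close> alone.\<close>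

theorem theorem1p1:
  shows "\<exists>\<epsilon> :: real \<Rightarrow> real. (\<epsilon> \<longlongrightarrow> 0) at_top \<and>
    (\<forall>d::real. d > 0 \<longrightarrow> (\<exists>\<gamma>::nat. \<forall>k::nat \<Rightarrow> nat.
       (\<forall>n. real (k n) \<le> (1 - \<epsilon> d) * (ln d / d) * real n) \<longrightarrow>
       ((\<lambda>n. measure_pmf.prob (Gnm n (nat \<lfloor>d * real n / 2\<rfloor>))
                {E. gamma_connected \<gamma> (indep_sets n E (k n))}) \<longlonglongrightarrow> 1)))"
proof -
  \<comment> \<open>For \<open>d \<ge> 3\<close> this solves
    \<open>d powr \<epsilon> d = 12 * ln d ^ 2\<close>. The value 1 below 3 forces
    \<open>k n = 0\<close>, where the empty set is the only independent set.\<close>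
  define \<epsilon> :: "real \<Rightarrow> real" where "\<epsilon> d = (if d < 3 then 1 else ln (12 * ln d ^ 2) / ln d)" for d
  have "((\<lambda>d::real. ln (12 * ln d ^ 2) / ln d) \<longlongrightarrow> 0) at_top" by real_asymp
  moreover have "\<forall>\<^sub>F d in at_top. ln (12 * ln d ^ 2) / ln d = \<epsilon> d"
    using eventually_ge_at_top[of 3] by eventually_elim (simp add: \<epsilon>_def)
  ultimately have lim: "(\<epsilon> \<longlongrightarrow> 0) at_top" by (rule Lim_transform_eventually)
  have "\<exists>\<gamma>::nat. \<forall>k::nat \<Rightarrow> nat. (\<forall>n. real (k n) \<le> (1 - \<epsilon> d) * (ln d / d) * real n) \<longrightarrow>
       ((\<lambda>n. measure_pmf.prob (Gnm n (nat \<lfloor>d * real n / 2\<rfloor>))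
                {E. gamma_connected \<gamma> (indep_sets n E (k n))}) \<longlonglongrightarrow> 1)" if d0: "d > 0" for d
  proof (cases "d < 3")
    case True
    show ?thesis
    proof (intro exI allI impI)
      fix k :: "nat \<Rightarrow> nat" assume "\<forall>n. real (k n) \<le> (1 - \<epsilon> d) * (ln d / d) * real n"
      then have "k n = 0" for n using True by (simp add: \<epsilon>_def)
      then show "(\<lambda>n. measure_pmf.prob (Gnm n (nat \<lfloor>d * real n / 2\<rfloor>))
                {E. gamma_connected 0 (indep_sets n E (k n))}) \<longlonglongrightarrow> 1"
        by (simp add: gamma_connected_indep_sets_0)
    qed
  next
    case False
    then have d: "d \<ge> 3" by simp
    have "exp 1 \<le> d" using exp_le d by linarith
    then have ln1: "1 \<le> ln d" using d by (subst ln_ge_iff) auto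
    define \<Delta> where "\<Delta> = nat \<lceil>12 * d\<rceil>"
    have \<Delta>: "12 * d \<le> real \<Delta>" unfolding \<Delta>_def by linarith
    then have "6 \<le> \<Delta>" using d by linarith
    define c where "c = (1 - \<epsilon> d) * (ln d / d)"
    have "1 \<le> ln d ^ 2" using ln1 by simp
    then have ln12: "0 \<le> ln (12 * ln d ^ 2)" by (intro ln_ge_zero) linarith
    have c_le: "c \<le> ln d / d"
      using ln12 ln1 d by (simp add: c_def \<epsilon>_def field_simps)
    have "c * d = ln d - ln (12 * ln d ^ 2)"
      using ln1 d by (simp add: c_def \<epsilon>_def field_simps)
    then have exp_c: "exp (- c * d) = 12 * ln d ^ 2 / d"
      using ln1 d by (simp add: exp_diff)
    show ?thesis
    proof (intro exI[of _ "2 * Suc \<Delta>"] allI impI)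
      fix k :: "nat \<Rightarrow> nat" assume "\<forall>n. real (k n) \<le> (1 - \<epsilon> d) * (ln d / d) * real n"
      then have k: "real (k n) \<le> c * real n" for n by (simp add: c_def)
      \<comment> \<open>For moderate \<open>d\<close> the constant \<open>c\<close> can be negative,
        but then no \<open>k\<close> satisfies the bound, as \<open>n = 1\<close> shows.\<close>
      have c0: "0 \<le> c" using k[of 1] by simp
      define m where "m n = nat \<lfloor>d * real n / 2\<rfloor>" for n
      have m: "real (m n) \<le> d * real n / 2" for n
        unfolding m_def using d by (intro of_nat_floor) simp
      define p1 where "p1 n = real (n choose k n) * real (Suc (n choose 2)) *
        (1 - (1 - real (m n) / real (n choose 2)) ^ k n) ^ (n - k n)" for n
      have p1: "p1 \<longlonglongrightarrow> 0"
        unfolding p1_def using domination_bound_tendsto_0[OF d c0 c_le exp_c k m] .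
      \<comment> \<open>Beyond \<open>d + 1\<close>, the number \<open>d * n / 2\<close> is below
        \<open>n choose 2\<close>, so \<open>m n\<close> edges do not exhaust the complete
        graph.\<close>
      have "\<forall>\<^sub>F n in at_top. real n > d + 1" by real_asymp
      then have lower: "\<forall>\<^sub>F n in at_top. 1 - p1 n - 1 / real n \<le> measure_pmf.prob (Gnm n (m n))
          {E. gamma_connected (2 * Suc \<Delta>) (indep_sets n E (k n))}"
      proof eventually_elim
        case (elim n)
        have n: "4 < real n" using elim d by linarith
        have N: "real (n choose 2) = real n * (real n - 1) / 2"
          using n by (simp add: choose_two real_of_nat_div of_nat_diff)
        have "d * real n < real n * (real n - 1)"
          using elim n by (subst mult.commute, intro mult_strict_left_mono) auto
        then have "real (m n) < real (n choose 2)" using m[of n] N by linarith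
        then have mN: "m n < n choose 2" by simp
        have "ln d \<le> d" using ln_le_minus_one[of d] d by linarith
        then have "c \<le> 1" using c_le d by (auto intro: order_trans)
        then have "k n \<le> n"
          using k[of n] mult_right_mono[of c 1 "real n"] by simp
        then show ?case unfolding p1_def
          using d0 \<Delta> \<open>6 \<le> \<Delta>\<close> n m mN by (intro prob_gamma_connected_ge[of d]) auto
      qed
      have "(\<lambda>n. 1 / real n) \<longlonglongrightarrow> 0" by real_asymp
      with p1 have "(\<lambda>n. 1 - p1 n - 1 / real n) \<longlonglongrightarrow> 1 - 0 - 0"
        by (intro tendsto_intros)
      then have lower_lim: "(\<lambda>n. 1 - p1 n - 1 / real n) \<longlonglongrightarrow> 1" by simp
      show "(\<lambda>n. measure_pmf.prob (Gnm n (nat \<lfloor>d * real n / 2\<rfloor>))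
          {E. gamma_connected (2 * Suc \<Delta>) (indep_sets n E (k n))}) \<longlonglongrightarrow> 1"
        unfolding m_def[symmetric]
        by (rule tendsto_sandwich[OF lower _ lower_lim tendsto_const]) simp
    qed
  qed
  with lim show ?thesis by blast
qed

end
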